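(* Let $\{K_F: F\in\mathcal{K}(\mathbb{Q})\}$ be a $\mathcal{K}(\mathbb{Q})$-directed compact cover of $2^{\omega_1}$. Then there exists an $F\in\mathcal{K}(\mathbb{Q})$ such that $K_F$ is BIG.
   Context: $\mathbb{Q}$ is the space of rational numbers, and $\mathcal{K}(\mathbb{Q})$ is the collection of all compact subsets of $\mathbb{Q}$, directed by inclusion. $2^{\omega_1}$ carries the product topology ($2=\{0,1\}$ discrete). A $\mathcal{K}(\mathbb{Q})$-directed compact cover of $2^{\omega_1}$ is a family $\{K_F:F\in\mathcal{K}(\mathbb{Q})\}$ of compact subsets with union $2^{\omega_1}$ such that $K_F\subseteq K_{F'}$ whenever $F\subseteq F'$. A subset $Y\subseteq 2^{\omega_1}$ is BIG if it is compact and there is $\delta\in\omega_1$ with $\pi_\delta[Y]=2^{\omega_1\setminus\delta}$, where $\pi_\delta[Y]=\{y{\upharpoonright}_{\omega_1\setminus\delta}:y\in Y\}$. *)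

theory Defs
  imports "HOL-Analysis.Analysis" "HOL-Library.Countable_Set_Type"
begin

(* The ordinal omega_1 as a type: natLeq is the well-order of the natural numbers, and
   cardSuc natLeq is its cardinal successor, realised as a well-order on sets of naturals. *)
typedef omega1 = "Field (cardSuc natLeq)"
  using Field_cardSuc_not_empty[OF natLeq_Card_order] by blast

instantiation omega1 :: wellorder
begin

definition less_eq_omega1 :: "omega1 \<Rightarrow> omega1 \<Rightarrow> bool" where
  "(x :: omega1) \<le> y \<longleftrightarrow> (Rep_omega1 x, Rep_omega1 y) \<in> cardSuc natLeq"

definition less_omega1 :: "omega1 \<Rightarrow> omega1 \<Rightarrow> bool" where
  "(x :: omega1) < y \<longleftrightarrow> x \<le> y \<and> x \<noteq> y"

instance
proof -
  have "Well_order (cardSuc natLeq)"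
    using cardSuc_Well_order[OF natLeq_Card_order] .
  then have refl: "(a, a) \<in> cardSuc natLeq" if "a \<in> Field (cardSuc natLeq)" for a
    using that by (auto simp: order_on_defs refl_on_def)
  have tr: "trans (cardSuc natLeq)" and asym: "antisym (cardSuc natLeq)"
    and tot: "Total (cardSuc natLeq)" and wf: "wf (cardSuc natLeq - Id)"
    using \<open>Well_order (cardSuc natLeq)\<close> by (auto simp: order_on_defs)
  have as: "x = y" if "x \<le> y" "y \<le> x" for x y :: omega1
    using antisymD[OF asym that[unfolded less_eq_omega1_def]] by (simp add: Rep_omega1_inject)
  have "wf (inv_image (cardSuc natLeq - Id) Rep_omega1)"
    using wf by (rule wf_inv_image)
  moreover have "{(x, y). x < y} = inv_image (cardSuc natLeq - Id) Rep_omega1"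
    by (auto simp: less_omega1_def less_eq_omega1_def Rep_omega1_inject inv_image_def)
  ultimately have wfl: "wf {(x :: omega1, y). x < y}"
    by simp
  show "OFCLASS(omega1, wellorder_class)"
  proof
    fix x y z :: omega1 and P :: "omega1 \<Rightarrow> bool"
    show "x < y \<longleftrightarrow> x \<le> y \<and> \<not> y \<le> x"
      using as refl[OF Rep_omega1] by (auto simp: less_omega1_def less_eq_omega1_def)
    show "x \<le> x"
      using refl[OF Rep_omega1] by (simp add: less_eq_omega1_def)
    show "x \<le> z" if "x \<le> y" "y \<le> z"
      using transD[OF tr that[unfolded less_eq_omega1_def]] by (simp add: less_eq_omega1_def)
    show "x = y" if "x \<le> y" "y \<le> x"
      using that by (rule as)
    show "x \<le> y \<or> y \<le> x"
      using tot refl Rep_omega1[of x] Rep_omega1[of y]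
      unfolding less_eq_omega1_def total_on_def by metis
    show "P a" if "\<And>x. (\<And>y. y < x \<Longrightarrow> P y) \<Longrightarrow> P x" for a
    proof (rule wf_induct_rule[OF wfl, of P a])
      show "P x" if "\<And>y. (y, x) \<in> {(x, y). x < y} \<Longrightarrow> P y" for x
        using \<open>\<And>x. (\<And>y. y < x \<Longrightarrow> P y) \<Longrightarrow> P x\<close>[of x] that by simp
    qed
  qed
qed

end

lemma uncountable_omega1:
  includes cardinal_syntax
  shows "\<not> countable (UNIV :: omega1 set)"
proof
  assume "countable (UNIV :: omega1 set)"
  then have "countable (range Rep_omega1)"
    by simp
  then have "countable (Field (cardSuc natLeq))"
    using type_definition.Rep_range[OF type_definition_omega1] by simp
  then have "|Field (cardSuc natLeq)| \<le>o natLeq"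
    using countable_card_le_natLeq by blast
  moreover have "|Field (cardSuc natLeq)| =o cardSuc natLeq"
    using card_of_Field_ordIso[OF cardSuc_Card_order[OF natLeq_Card_order]] .
  ultimately have "cardSuc natLeq \<le>o natLeq"
    using ordIso_ordLeq_trans ordIso_symmetric by blast
  then show False
    using cardSuc_greater[OF natLeq_Card_order] not_ordLess_ordLeq by blast
qed

lemma countable_lessThan_omega1:
  includes cardinal_syntax
  shows "countable {..<\<delta> :: omega1}"
proof -
  have "|underS (cardSuc natLeq) (Rep_omega1 \<delta>)| <o cardSuc natLeq"
    using card_of_underS[OF cardSuc_Card_order[OF natLeq_Card_order] Rep_omega1] .
  then have "|underS (cardSuc natLeq) (Rep_omega1 \<delta>)| \<le>o natLeq"
    using cardSuc_ordLess_ordLeq[OF natLeq_Card_order card_of_Card_order]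
      cardSuc_ordLeq_ordLess[OF natLeq_Card_order card_of_Card_order] by blast
  then have "countable (underS (cardSuc natLeq) (Rep_omega1 \<delta>))"
    using countable_card_le_natLeq by blast
  moreover have "Rep_omega1 ` {..<\<delta>} \<subseteq> underS (cardSuc natLeq) (Rep_omega1 \<delta>)"
    by (auto simp: underS_def less_omega1_def less_eq_omega1_def Rep_omega1_inject)
  ultimately have "countable (Rep_omega1 ` {..<\<delta>})"
    using countable_subset by blast
  then show ?thesis
    using countable_image_inj_on[of Rep_omega1] by (auto simp: inj_on_def Rep_omega1_inject)
qed

(* The library topologies on bool and on function types are the discrete one and the product
   one, so the topological space omega1 => bool is the Cantor cube 2^(omega_1). *)
type_synonym cantor_cube = "omega1 \<Rightarrow> bool"

(* The rationals as a subspace of the real line (type rat carries no topology). *)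
definition compact_sets_rat :: "real set set" where
  "compact_sets_rat = {F. compactin (top_of_set \<rat>) F}"

(* Only the values K F with F in the index family P are relevant. *)
definition directed_compact_cover ::
    "'i set set \<Rightarrow> ('i set \<Rightarrow> 'a::topological_space set) \<Rightarrow> bool" where
  "directed_compact_cover P K \<longleftrightarrow>
     (\<forall>F\<in>P. compact (K F)) \<and>
     (\<Union>F\<in>P. K F) = UNIV \<and>
     (\<forall>F\<in>P. \<forall>F'\<in>P. F \<subseteq> F' \<longrightarrow> K F \<subseteq> K F')"

(* As delta is the set of its predecessors, its complement in omega_1 is {delta..}; elements of
   2^(omega_1 - delta) are extensional functions on that set. *)
definition proj_tail :: "omega1 \<Rightarrow> cantor_cube set \<Rightarrow> cantor_cube set" where
  "proj_tail \<delta> Y = (\<lambda>y. restrict y {\<delta>..}) ` Y"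

definition BIG :: "cantor_cube set \<Rightarrow> bool" where
  "BIG Y \<longleftrightarrow> compact Y \<and> (\<exists>\<delta>. proj_tail \<delta> Y = {\<delta>..} \<rightarrow>\<^sub>E UNIV)"

end

theory Submission
  imports Defs
begin

text \<open>
  The proof compares the directed family with functions from \<open>\<nat>\<close> to \<open>\<nat>\<close>. Everything is
  measured by finite conditions: for finite \<open>a\<close>, \<open>b \<subseteq> \<omega>\<^sub>1\<close> let \<open>cyl a b\<close> be the set of points
  whose restriction to \<open>a\<close> is the indicator function of \<open>b\<close>. By compactness a compact set
  is BIG as soon as it meets every \<open>cyl a b\<close> with \<open>a\<close> above some fixed \<open>\<delta>\<close>.

  The main new ingredient is that whenever the cube is covered by countably many sets, one of
  them contains a countable set that is dense in a final subproduct
  (\<open>countable_cover_finally_dense\<close>). It is applied to the sets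
  \<open>\<Union>{K G | G \<subseteq> V}\<close>, where \<open>V\<close> runs over a countable base for the compact subsets of the
  line: those of them without such a countable dense set cannot cover the cube, and if a point
  outside them lies in \<open>K F\<close>, then every \<open>V \<supseteq> F\<close> yields such a dense set. So for each \<open>n\<close> there are a
  finally dense sequence \<open>(d n k)\<^sub>k\<close> and compact sets \<open>G n k\<close> of rationals within \<open>1 / (n + 1)\<close>
  of \<open>F\<close> such that \<open>d n k \<in> K (G n k)\<close>. For every \<open>h : \<nat> \<rightarrow> \<nat>\<close> the set
  \<open>F\<^sub>h = F \<union> \<Union>{G n k | k \<le> h n}\<close> is again compact, because outside every neighbourhood of \<open>F\<close>
  only finitely many of the \<open>G n k\<close> contribute points, and \<open>K F\<^sub>h\<close> contains all \<open>d n k\<close> with \<open>k \<le> h n\<close>.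

  Suppose that no \<open>K E\<close> is BIG. Then for each \<open>h\<close> some condition \<open>(a, b)\<close> is missed by
  \<open>K F\<^sub>h\<close>, which means that \<open>h n < \<phi> (a, b) n\<close> for all \<open>n\<close>, where \<open>\<phi> (a, b) n\<close> is the least \<open>k\<close>
  with \<open>d n k \<in> cyl a b\<close>. As there are only \<open>\<aleph>\<^sub>1\<close> conditions, this is a dominating
  family of size \<open>\<aleph>\<^sub>1\<close>. Such a family makes the cofinality of the compact sets of
  rationals at most \<open>\<aleph>\<^sub>1\<close> (\<open>compact_sets_rat_cofinal_omega1\<close>), so the cube is the union of
  \<open>\<aleph>\<^sub>1\<close> of the sets \<open>K E\<close>. But \<open>\<aleph>\<^sub>1\<close> compact sets that are not BIG miss finite conditions
  with pairwise disjoint supports, hence they have a common missing point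
  (\<open>omega1_many_not_BIG_do_not_cover\<close>).
\<close>

section \<open>Countable and \<open>\<aleph>\<^sub>1\<close>-sized sets\<close>

lemma countable_imp_bounded_omega1:
  assumes "countable C"
  obtains \<delta> :: omega1 where "\<And>\<gamma>. \<gamma> \<in> C \<Longrightarrow> \<gamma> < \<delta>"
proof -
  have "countable (\<Union>\<gamma>\<in>C. {..\<gamma>})"
    using assms countable_lessThan_omega1 by (auto simp: lessThan_Suc_atMost ivl_disj_un_singleton(2)[symmetric])
  then have "(\<Union>\<gamma>\<in>C. {..\<gamma>}) \<noteq> UNIV"
    using uncountable_omega1 by auto
  then obtain \<delta> where "\<forall>\<gamma>\<in>C. \<not> \<delta> \<le> \<gamma>"
    by auto
  then show thesis
    using that by (meson not_le)
qed

lemma omega1_enumeration: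
  includes cardinal_syntax
  assumes "\<And>\<xi> :: omega1. countable (A \<xi>)" and "(\<Union>\<xi>. A \<xi>) \<noteq> {}"
  obtains g :: "omega1 \<Rightarrow> 'a" where "range g = (\<Union>\<xi>. A \<xi>)"
proof -
  have inf: "infinite (UNIV :: omega1 set)"
    using uncountable_omega1 countable_finite by blast
  have "|A \<xi>| \<le>o |UNIV :: omega1 set|" for \<xi>
    using assms(1)[of \<xi>] inf
    by (meson countable_card_le_natLeq infinite_iff_natLeq_ordLeq ordLeq_transitive)
  then have "|\<Union>\<xi>. A \<xi>| \<le>o |UNIV :: omega1 set|"
    using card_of_UNION_ordLeq_infinite[OF inf, of UNIV A] by (simp add: card_of_mono1)
  then have "\<exists>g. g ` (UNIV :: omega1 set) = (\<Union>\<xi>. A \<xi>)"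
    using card_of_ordLeq2[OF assms(2), of "UNIV :: omega1 set"] by simp
  then show thesis
    by (elim exE) (rule that)
qed

section \<open>Cylinders and BIG sets\<close>

definition cyl :: "omega1 set \<Rightarrow> omega1 set \<Rightarrow> cantor_cube set" where
  "cyl a b = {x. \<forall>\<alpha>\<in>a. x \<alpha> \<longleftrightarrow> \<alpha> \<in> b}"

text \<open>
  Given a point \<open>w\<close> of the final subproduct, the closed conditions \<open>x \<alpha> = w \<alpha>\<close> for \<open>\<alpha> \<ge> \<delta>\<close>
  have the finite intersection property on \<open>Y\<close>, because finitely many of them form a cylinder.
\<close>

lemma BIG_if_meets_cylinders:
  assumes "compact Y"
    and meets: "\<And>a b. \<lbrakk>finite a; finite b; a \<subseteq> {\<delta>..}\<rbrakk> \<Longrightarrow> Y \<inter> cyl a b \<noteq> {}"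
  shows "BIG Y"
proof -
  have "w \<in> proj_tail \<delta> Y" if w: "w \<in> {\<delta>..} \<rightarrow>\<^sub>E UNIV" for w
  proof -
    have "Y \<inter> (\<Inter>\<alpha>\<in>{\<delta>..}. {x. x \<alpha> = w \<alpha>}) \<noteq> {}"
    proof (rule compact_imp_fip_image[OF \<open>compact Y\<close>])
      show "closed {x :: cantor_cube. x \<alpha> = w \<alpha>}" for \<alpha>
        by (intro closed_Collect_eq continuous_on_product_coordinates continuous_on_const)
      show "Y \<inter> (\<Inter>\<alpha>\<in>a. {x. x \<alpha> = w \<alpha>}) \<noteq> {}" if "finite a" "a \<subseteq> {\<delta>..}" for a
        using meets[of a "{\<alpha>\<in>a. w \<alpha>}"] that unfolding cyl_def by fastforce
    qed
    then obtain y where "y \<in> Y" "\<forall>\<alpha>\<ge>\<delta>. y \<alpha> = w \<alpha>"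
      by auto
    moreover from this w have "restrict y {\<delta>..} = w"
      by (auto simp: restrict_def PiE_def extensional_def)
    ultimately show ?thesis
      unfolding proj_tail_def by blast
  qed
  then have "proj_tail \<delta> Y = {\<delta>..} \<rightarrow>\<^sub>E UNIV"
    unfolding proj_tail_def by auto
  with \<open>compact Y\<close> show ?thesis
    unfolding BIG_def by blast
qed

text \<open>
  A compact set that is not BIG misses, beyond every \<open>\<delta>\<close>, a cylinder with support beyond \<open>\<delta>\<close>.
  Transfinite recursion moves \<open>\<delta>\<close> past all earlier supports; conditions with pairwise disjoint
  supports are satisfied by one common point, which lies in none of the sets.
\<close>

lemma omega1_many_not_BIG_do_not_cover:
  fixes Y :: "omega1 \<Rightarrow> cantor_cube set"
  assumes "\<And>\<xi>. compact (Y \<xi>)" and "\<And>\<xi>. \<not> BIG (Y \<xi>)"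
  shows "(\<Union>\<xi>. Y \<xi>) \<noteq> UNIV"
proof -
  have "\<exists>p. finite (fst p) \<and> fst p \<subseteq> {\<delta>..} \<and> Y \<xi> \<inter> cyl (fst p) (snd p) = {}" for \<xi> \<delta>
    using BIG_if_meets_cylinders[of "Y \<xi>" \<delta>] assms by (metis fst_conv snd_conv)
  then have "\<forall>\<xi>. \<exists>p. \<forall>\<delta>. finite (fst (p \<delta>)) \<and> fst (p \<delta>) \<subseteq> {\<delta>..} \<and> Y \<xi> \<inter> cyl (fst (p \<delta>)) (snd (p \<delta>)) = {}"
    by (intro allI choice) blast
  from choice[OF this] obtain p where p: "\<And>\<xi> \<delta>. finite (fst (p \<xi> \<delta>)) \<and> fst (p \<xi> \<delta>) \<subseteq> {\<delta>..}
      \<and> Y \<xi> \<inter> cyl (fst (p \<xi> \<delta>)) (snd (p \<xi> \<delta>)) = {}"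
    by blast
  define a b where "a \<xi> \<delta> = fst (p \<xi> \<delta>)" and "b \<xi> \<delta> = snd (p \<xi> \<delta>)" for \<xi> \<delta>
  have fin: "finite (a \<xi> \<delta>)" and ge: "a \<xi> \<delta> \<subseteq> {\<delta>..}"
    and miss: "Y \<xi> \<inter> cyl (a \<xi> \<delta>) (b \<xi> \<delta>) = {}" for \<xi> \<delta>
    using p unfolding a_def b_def by auto
  \<comment> \<open>At stage \<open>\<xi>\<close> the missed cylinder is chosen beyond \<open>D \<xi>\<close>, and \<open>D \<xi>\<close> exceeds the countably
    many coordinates used so far.\<close>
  have "\<exists>D. \<forall>\<xi>. \<forall>\<zeta><\<xi>. \<forall>\<alpha>\<in>a \<zeta> (D \<zeta>). \<alpha> < D \<xi>"
  proof (rule dependent_wellorder_choice)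
    show "\<exists>\<delta>. \<forall>\<zeta><\<xi>. \<forall>\<alpha>\<in>a \<zeta> (D \<zeta>). \<alpha> < \<delta>" for \<xi> and D :: "omega1 \<Rightarrow> omega1"
    proof -
      have "countable (\<Union>\<zeta>\<in>{..<\<xi>}. a \<zeta> (D \<zeta>))"
        using countable_lessThan_omega1 fin by (intro countable_UN) (auto intro: countable_finite)
      then obtain \<delta> where "\<And>\<alpha>. \<alpha> \<in> (\<Union>\<zeta>\<in>{..<\<xi>}. a \<zeta> (D \<zeta>)) \<Longrightarrow> \<alpha> < \<delta>"
        using countable_imp_bounded_omega1 by blast
      then show ?thesis by blast
    qed
  qed simp
  then obtain D where D: "\<And>\<xi> \<zeta> \<alpha>. \<lbrakk>\<zeta> < \<xi>; \<alpha> \<in> a \<zeta> (D \<zeta>)\<rbrakk> \<Longrightarrow> \<alpha> < D \<xi>"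
    by blast
  have same: "\<xi> = \<zeta>" if "\<alpha> \<in> a \<xi> (D \<xi>)" "\<alpha> \<in> a \<zeta> (D \<zeta>)" for \<xi> \<zeta> \<alpha>
    using that D ge by (metis atLeast_iff leD linorder_neqE subsetD)
  define z where "z \<alpha> \<longleftrightarrow> (\<exists>\<xi>. \<alpha> \<in> a \<xi> (D \<xi>) \<inter> b \<xi> (D \<xi>))" for \<alpha>
  have "z \<in> cyl (a \<xi> (D \<xi>)) (b \<xi> (D \<xi>))" for \<xi>
    unfolding cyl_def z_def using same by blast
  with miss have "z \<notin> Y \<xi>" for \<xi>
    by blast
  then show ?thesis by blast
qed

section \<open>Countable covers of the cube\<close>

text \<open>
  The Baire category theorem for \<open>2\<^sup>S\<close> with countable \<open>S\<close>, in terms of finite partial functions: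
  if the piece \<open>C n\<close> is not dense below the finite condition \<open>w\<close> on \<open>T\<close>, then this condition
  extends to one that avoids \<open>C n\<close>; were this possible for all \<open>n\<close> and all conditions, iterating
  it would produce a point outside every piece.
\<close>

lemma Baire_boolean_functions:
  fixes C :: "nat \<Rightarrow> ('s :: countable \<Rightarrow> bool) set"
  assumes "(\<Union>n. C n) = UNIV"
  obtains n T w where "finite T"
    and "\<And>S v. \<lbrakk>finite S; T \<subseteq> S; \<forall>s\<in>T. v s = w s\<rbrakk> \<Longrightarrow> \<exists>z\<in>C n. \<forall>s\<in>S. z s = v s"
proof (rule ccontr)
  assume "\<not> thesis"
  with that have ext: "\<exists>S v. finite S \<and> T \<subseteq> S \<and> (\<forall>s\<in>T. v s = w s)
      \<and> (\<forall>z\<in>C n. \<exists>s\<in>S. z s \<noteq> v s)" if "finite T" for n T w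
    using \<open>finite T\<close> by metis
  have "\<exists>p :: nat \<Rightarrow> 's set \<times> ('s \<Rightarrow> bool). \<forall>n. finite (fst (p n)) \<and>
      (fst (p n) \<subseteq> fst (p (Suc n)) \<and> (\<forall>s\<in>fst (p n). snd (p (Suc n)) s = snd (p n) s)
      \<and> (\<forall>z\<in>C n. \<exists>s\<in>fst (p (Suc n)). z s \<noteq> snd (p (Suc n)) s))"
  proof (rule dependent_nat_choice)
    show "\<exists>p :: 's set \<times> ('s \<Rightarrow> bool). finite (fst p)"
      by (rule exI[of _ "({}, \<lambda>_. True)"]) simp
  qed (use ext in force)
  then obtain p :: "nat \<Rightarrow> 's set \<times> ('s \<Rightarrow> bool)" where
    mono: "\<And>n. fst (p n) \<subseteq> fst (p (Suc n))"
    and agree: "\<And>n s. s \<in> fst (p n) \<Longrightarrow> snd (p (Suc n)) s = snd (p n) s"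
    and miss: "\<And>n z. z \<in> C n \<Longrightarrow> \<exists>s\<in>fst (p (Suc n)). z s \<noteq> snd (p (Suc n)) s"
    by metis
  have coh: "s \<in> fst (p m) \<and> snd (p m) s = snd (p n) s" if "n \<le> m" "s \<in> fst (p n)" for n m s
    using that by (induction m rule: dec_induct) (use mono agree in auto)
  define z where "z s = (\<exists>n. s \<in> fst (p n) \<and> snd (p n) s)" for s
  have z: "z s = snd (p n) s" if "s \<in> fst (p n)" for s n
    unfolding z_def using that coh by (metis nle_le)
  obtain n where "z \<in> C n"
    using assms by blast
  then show False
    using miss z by blast
qed

definition finally_dense :: "cantor_cube set \<Rightarrow> bool" where
  "finally_dense D \<longleftrightarrow>
     (\<exists>\<delta>. \<forall>a b. finite a \<longrightarrow> finite b \<longrightarrow> a \<subseteq> {\<delta>..} \<longrightarrow> D \<inter> cyl a b \<noteq> {})"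

text \<open>
  Elements of \<open>\<omega>\<^sub>1\<close> are represented by distinct sets of natural numbers; the finite initial
  segments of these subsets of \<open>\<nat>\<close> distinguish any finitely many elements of \<open>\<omega>\<^sub>1\<close>.
\<close>

definition real_prefix :: "omega1 \<Rightarrow> nat \<Rightarrow> bool list" where
  "real_prefix \<alpha> n = map (\<lambda>i. i \<in> Rep_omega1 \<alpha>) [0..<n]"

lemma length_real_prefix [simp]: "length (real_prefix \<alpha> n) = n"
  by (simp add: real_prefix_def)

lemma real_prefixes_separate:
  assumes "finite a"
  obtains L where "\<And>\<alpha> \<beta> m n. \<lbrakk>\<alpha> \<in> a; \<beta> \<in> a; n \<ge> L; real_prefix \<alpha> n = real_prefix \<beta> m\<rbrakk> \<Longrightarrow> \<alpha> = \<beta>"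
proof -
  have "\<exists>i. \<alpha> \<noteq> \<beta> \<longrightarrow> (i \<in> Rep_omega1 \<alpha>) \<noteq> (i \<in> Rep_omega1 \<beta>)" for \<alpha> \<beta>
    using Rep_omega1_inject by blast
  then obtain i where i: "\<And>\<alpha> \<beta>. \<alpha> \<noteq> \<beta> \<Longrightarrow> (i \<alpha> \<beta> \<in> Rep_omega1 \<alpha>) \<noteq> (i \<alpha> \<beta> \<in> Rep_omega1 \<beta>)"
    by metis
  have "finite ((\<lambda>(\<alpha>, \<beta>). i \<alpha> \<beta>) ` (a \<times> a))"
    using assms by simp
  then obtain L where "\<forall>k\<in>(\<lambda>(\<alpha>, \<beta>). i \<alpha> \<beta>) ` (a \<times> a). k < L"
    by (meson finite_nat_set_iff_bounded)
  then have L: "i \<alpha> \<beta> < L" if "\<alpha> \<in> a" "\<beta> \<in> a" for \<alpha> \<beta>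
    using that by auto
  have "\<alpha> = \<beta>" if "\<alpha> \<in> a" "\<beta> \<in> a" "n \<ge> L" and eq: "real_prefix \<alpha> n = real_prefix \<beta> m" for \<alpha> \<beta> m n
  proof (rule ccontr)
    assume "\<alpha> \<noteq> \<beta>"
    have "m = n"
      using eq by (metis length_real_prefix)
    have "i \<alpha> \<beta> < n"
      using L that by (meson less_le_trans)
    then have "(i \<alpha> \<beta> \<in> Rep_omega1 \<alpha>) = (i \<alpha> \<beta> \<in> Rep_omega1 \<beta>)"
      using eq \<open>m = n\<close> by (simp add: real_prefix_def)
    with i[OF \<open>\<alpha> \<noteq> \<beta>\<close>] show False by simp
  qed
  then show thesis
    by (rule that)
qed

text \<open>
  Fix injections \<open>e \<alpha>\<close> of \<open>{..<\<alpha>}\<close> into \<open>\<nat>\<close>. For \<open>\<beta> < \<omega>\<^sub>1\<close> and a colouring \<open>z\<close> of the finite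
  binary words let the point \<open>x \<beta> z\<close> have at \<open>\<alpha>\<close> the colour of the initial segment of length
  \<open>e \<alpha> \<beta>\<close> of the set of natural numbers attached to \<open>\<alpha>\<close>. By Baire category, for each \<open>\<beta>\<close> some piece \<open>B n\<close>
  contains \<open>x \<beta> z\<close> for a set of colourings \<open>z\<close> that is dense below a condition involving only words
  shorter than some \<open>l\<close>. The pair \<open>(n, l)\<close> is the same for infinitely many \<open>\<beta>\<close>, and countably
  many of these \<open>\<beta>\<close> suffice: given finitely many \<open>\<alpha>\<close> above them, injectivity makes all the lengths
  \<open>e \<alpha> \<beta>\<close> large for some \<open>\<beta>\<close>. Then the relevant words are pairwise different and longer than \<open>l\<close>,
  so their colours can be prescribed at will.
\<close>

lemma countable_cover_finally_dense_sequence: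
  fixes B :: "nat \<Rightarrow> cantor_cube set"
  assumes "(\<Union>n. B n) = UNIV"
  shows "\<exists>n D. countable D \<and> D \<subseteq> B n \<and> finally_dense D"
proof -
  define e where "e \<alpha> = to_nat_on {..<\<alpha>}" for \<alpha> :: omega1
  have inj_e: "inj_on (e \<alpha>) {..<\<alpha>}" for \<alpha>
    unfolding e_def using countable_lessThan_omega1 by (rule inj_on_to_nat_on)
  define x :: "omega1 \<Rightarrow> (bool list \<Rightarrow> bool) \<Rightarrow> cantor_cube" where
    "x \<beta> z = (\<lambda>\<alpha>. z (real_prefix \<alpha> (e \<alpha> \<beta>)))" for \<beta> z
  have "\<exists>n l. \<forall>S V. finite S \<longrightarrow> (\<forall>s\<in>S. l \<le> length s)
      \<longrightarrow> (\<exists>z. x \<beta> z \<in> B n \<and> (\<forall>s\<in>S. z s \<longleftrightarrow> s \<in> V))" for \<beta>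
  proof -
    have "(\<Union>n. {z. x \<beta> z \<in> B n}) = UNIV"
      using assms by auto
    then obtain n T w where "finite T" and dense:
      "\<And>S v. \<lbrakk>finite S; T \<subseteq> S; \<forall>s\<in>T. v s = w s\<rbrakk> \<Longrightarrow> \<exists>z\<in>{z. x \<beta> z \<in> B n}. \<forall>s\<in>S. z s = v s"
      using Baire_boolean_functions[of "\<lambda>n. {z. x \<beta> z \<in> B n}"] by metis
    obtain l where l: "\<forall>k\<in>length ` T. k < l"
      using \<open>finite T\<close> by (meson finite_imageI finite_nat_set_iff_bounded)
    have "\<exists>z. x \<beta> z \<in> B n \<and> (\<forall>s\<in>S. z s \<longleftrightarrow> s \<in> V)" if "finite S" "\<forall>s\<in>S. l \<le> length s" for S V
    proof -
      have disj: "s \<notin> T" if "s \<in> S" for s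
        using that l \<open>\<forall>s\<in>S. l \<le> length s\<close> by fastforce
      have "\<exists>z\<in>{z. x \<beta> z \<in> B n}. \<forall>s\<in>T \<union> S. z s = (if s \<in> T then w s else s \<in> V)"
        using dense[of "T \<union> S" "\<lambda>s. if s \<in> T then w s else s \<in> V"] \<open>finite T\<close> \<open>finite S\<close> by simp
      then show ?thesis
        using disj by fastforce
    qed
    then show ?thesis by blast
  qed
  then obtain n l where nl: "\<And>\<beta> S V. \<lbrakk>finite S; \<forall>s\<in>S. l \<beta> \<le> length s\<rbrakk>
      \<Longrightarrow> \<exists>z. x \<beta> z \<in> B (n \<beta>) \<and> (\<forall>s\<in>S. z s \<longleftrightarrow> s \<in> V)"
    by metis
  obtain n0 l0 where inf: "infinite {\<beta>. (n \<beta>, l \<beta>) = (n0, l0)}"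
  proof -
    have "\<exists>p. infinite {\<beta>. (n \<beta>, l \<beta>) = p}"
    proof (rule ccontr)
      assume "\<nexists>p. infinite {\<beta>. (n \<beta>, l \<beta>) = p}"
      then have "countable {\<beta>. (n \<beta>, l \<beta>) = p}" for p
        using countable_finite by blast
      then have "countable (\<Union>p. {\<beta>. (n \<beta>, l \<beta>) = p})"
        by (intro countable_UN countableI_type)
      moreover have "(\<Union>p. {\<beta>. (n \<beta>, l \<beta>) = p}) = UNIV"
        by auto
      ultimately show False
        using uncountable_omega1 by metis
    qed
    then show thesis
      using that by (metis surj_pair)
  qed
  then obtain J where J': "J \<subseteq> {\<beta>. (n \<beta>, l \<beta>) = (n0, l0)}" and "countable J" "infinite J"
    using infinite_countable_subset'[OF inf] by blast
  have J: "n \<beta> = n0" "l \<beta> = l0" if "\<beta> \<in> J" for \<beta>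
    using J' that by auto
  obtain \<delta> where \<delta>: "\<And>\<beta>. \<beta> \<in> J \<Longrightarrow> \<beta> < \<delta>"
    using countable_imp_bounded_omega1[OF \<open>countable J\<close>] by blast
  define z where "z \<beta> S V = (SOME z. x \<beta> z \<in> B n0 \<and> (\<forall>s\<in>S. z s \<longleftrightarrow> s \<in> V))" for \<beta> S V
  have z: "x \<beta> (z \<beta> S V) \<in> B n0 \<and> (\<forall>s\<in>S. z \<beta> S V s \<longleftrightarrow> s \<in> V)"
    if "finite S" "\<beta> \<in> J" "\<forall>s\<in>S. l0 \<le> length s" for \<beta> S V
  proof -
    have "\<exists>z. x \<beta> z \<in> B n0 \<and> (\<forall>s\<in>S. z s \<longleftrightarrow> s \<in> V)"
      using nl[of S \<beta> V] J[of \<beta>] that by simp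
    then show ?thesis
      unfolding z_def by (rule someI_ex)
  qed
  \<comment> \<open>\<open>z \<beta> S V\<close> realises the finite condition on the words in \<open>S\<close> with value true exactly on \<open>V\<close>;
    there are only countably many such conditions.\<close>
  define Fin :: "bool list set set" where "Fin = {S. finite S}"
  define D where "D = (\<lambda>(\<beta>, S, V). x \<beta> (z \<beta> S V)) ` (J \<times> {S \<in> Fin. \<forall>s\<in>S. l0 \<le> length s} \<times> Fin)"
  have "countable Fin"
    unfolding Fin_def using countable_Collect_finite_subset[of "UNIV :: bool list set"] by simp
  then have "countable D"
    unfolding D_def using \<open>countable J\<close>
    by (intro countable_image countable_SIGMA) (auto intro: countable_subset)
  moreover have "D \<subseteq> B n0"
    unfolding D_def Fin_def using z by auto
  moreover have "D \<inter> cyl a b \<noteq> {}" if "finite a" "finite b" "a \<subseteq> {\<delta>..}" for a b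
  proof -
    obtain L where L: "\<And>\<alpha> \<beta> m n. \<lbrakk>\<alpha> \<in> a; \<beta> \<in> a; n \<ge> L; real_prefix \<alpha> n = real_prefix \<beta> m\<rbrakk> \<Longrightarrow> \<alpha> = \<beta>"
      using real_prefixes_separate[OF \<open>finite a\<close>] by blast
    have "finite {\<beta> \<in> J. e \<alpha> \<beta> < max L l0}" if "\<alpha> \<in> a" for \<alpha>
    proof (rule inj_on_finite)
      have "J \<subseteq> {..<\<alpha>}"
        using \<delta> that \<open>a \<subseteq> {\<delta>..}\<close> by fastforce
      then show "inj_on (e \<alpha>) {\<beta> \<in> J. e \<alpha> \<beta> < max L l0}"
        by (intro inj_on_subset[OF inj_e]) auto
      show "e \<alpha> ` {\<beta> \<in> J. e \<alpha> \<beta> < max L l0} \<subseteq> {..<max L l0}"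
        by auto
    qed simp
    then have "finite (\<Union>\<alpha>\<in>a. {\<beta> \<in> J. e \<alpha> \<beta> < max L l0})"
      using \<open>finite a\<close> by blast
    then obtain \<beta> where "\<beta> \<in> J" and "\<beta> \<notin> (\<Union>\<alpha>\<in>a. {\<beta> \<in> J. e \<alpha> \<beta> < max L l0})"
      using \<open>infinite J\<close> by (meson finite_subset subsetI)
    then have ge: "L \<le> e \<alpha> \<beta>" "l0 \<le> e \<alpha> \<beta>" if "\<alpha> \<in> a" for \<alpha>
      using that by (auto simp: not_less)
    define S where "S = (\<lambda>\<alpha>. real_prefix \<alpha> (e \<alpha> \<beta>)) ` a"
    define V where "V = (\<lambda>\<alpha>. real_prefix \<alpha> (e \<alpha> \<beta>)) ` (a \<inter> b)"
    have S: "finite S" "\<forall>s\<in>S. l0 \<le> length s" and "finite V"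
      unfolding S_def V_def using \<open>finite a\<close> ge by auto
    have "x \<beta> (z \<beta> S V) \<alpha> \<longleftrightarrow> \<alpha> \<in> b" if "\<alpha> \<in> a" for \<alpha>
    proof -
      have "x \<beta> (z \<beta> S V) \<alpha> \<longleftrightarrow> real_prefix \<alpha> (e \<alpha> \<beta>) \<in> V"
        using z[OF S(1) \<open>\<beta> \<in> J\<close> S(2)] \<open>\<alpha> \<in> a\<close> by (simp add: x_def S_def)
      also have "\<dots> \<longleftrightarrow> \<alpha> \<in> b"
        unfolding V_def using L ge \<open>\<alpha> \<in> a\<close> by blast
      finally show ?thesis .
    qed
    then have "x \<beta> (z \<beta> S V) \<in> cyl a b"
      by (simp add: cyl_def)
    moreover have "x \<beta> (z \<beta> S V) \<in> D"
      unfolding D_def Fin_def using \<open>\<beta> \<in> J\<close> S \<open>finite V\<close> by force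
    ultimately show ?thesis by blast
  qed
  ultimately show ?thesis
    unfolding finally_dense_def by blast
qed

lemma countable_cover_finally_dense:
  fixes B :: "'i \<Rightarrow> cantor_cube set"
  assumes "countable I" and cov: "(\<Union>i\<in>I. B i) = UNIV"
  obtains i D where "i \<in> I" "countable D" "D \<subseteq> B i" "finally_dense D"
proof -
  have "I \<noteq> {}"
    using cov by auto
  then have r: "range (from_nat_into I) = I"
    using \<open>countable I\<close> by (rule range_from_nat_into)
  have "(\<Union>n. B (from_nat_into I n)) = (\<Union>i\<in>range (from_nat_into I). B i)"
    by simp
  then have "(\<Union>n. B (from_nat_into I n)) = UNIV"
    using cov r by simp
  then show thesis
    using countable_cover_finally_dense_sequence that \<open>I \<noteq> {}\<close> from_nat_into by metis
qed

section \<open>Compact sets of rationals and dominating families\<close>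

text \<open>
  A finite subfamily of an open cover that covers \<open>F\<close> also covers a uniform neighbourhood of \<open>F\<close>, hence
  all but finitely many of the sets \<open>C n\<close>.
\<close>

lemma compact_union_converging:
  fixes F :: "'a :: heine_borel set"
  assumes "compact F" and "\<And>n. compact (C n)"
    and near: "\<And>n. C n \<subseteq> (\<Union>y\<in>F. cball y (1 / Suc n))"
  shows "compact (F \<union> (\<Union>n. C n))"
proof (rule compactI)
  fix \<U> assume op: "\<forall>U\<in>\<U>. open U" and cov: "F \<union> (\<Union>n. C n) \<subseteq> \<Union>\<U>"
  obtain \<V> where \<V>: "\<V> \<subseteq> \<U>" "finite \<V>" "F \<subseteq> \<Union>\<V>"
    using compactE[OF \<open>compact F\<close>, of \<U>] op cov by (metis le_sup_iff)
  obtain e where "e > 0" and e: "(\<Union>y\<in>F. cball y e) \<subseteq> \<Union>\<V>"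
    using compact_subset_open_imp_cball_epsilon_subset[OF \<open>compact F\<close> _ \<open>F \<subseteq> \<Union>\<V>\<close>] \<V>(1) op
    by (metis open_Union subsetD)
  obtain N where N: "1 / Suc N < e"
    using nat_approx_posE[OF \<open>e > 0\<close>] by blast
  have tail: "C n \<subseteq> \<Union>\<V>" if "n \<ge> N" for n
  proof -
    have "1 / Suc n \<le> 1 / Suc N"
      using that by (simp add: frac_le)
    with N have "cball y (1 / Suc n) \<subseteq> cball y e" for y :: 'a
      by (intro subset_cball) linarith
    with near[of n] e show ?thesis by blast
  qed
  have "compact (\<Union>n\<in>{..<N}. C n)"
    using assms(2) by (intro compact_UN) auto
  then obtain \<W> where \<W>: "\<W> \<subseteq> \<U>" "finite \<W>" "(\<Union>n\<in>{..<N}. C n) \<subseteq> \<Union>\<W>"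
    using compactE[of _ \<U>] op cov by (metis (no_types, lifting) UN_subset_iff le_sup_iff subset_UNIV UNIV_I)
  have "C n \<subseteq> \<Union>(\<V> \<union> \<W>)" for n
    using tail[of n] \<W>(3) by (cases "n < N") auto
  then show "\<exists>D\<subseteq>\<U>. finite D \<and> F \<union> (\<Union>n. C n) \<subseteq> \<Union>D"
    using \<V> \<W> by (intro exI[of _ "\<V> \<union> \<W>"]) auto
qed

lemma compact_sets_rat_iff: "F \<in> compact_sets_rat \<longleftrightarrow> compact F \<and> F \<subseteq> \<rat>"
  by (simp add: compact_sets_rat_def compactin_subtopology)

text \<open>
  The pieces of the sequence \<open>E\<close> are cut down to balls that shrink to \<open>q\<close>, and each ball receives only
  finitely many of them, so that compactness is preserved; a larger \<open>f\<close> absorbs more of \<open>E\<close> near \<open>q\<close>.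
\<close>

definition cluster_union :: "real \<Rightarrow> (nat \<Rightarrow> real set) \<Rightarrow> (nat \<Rightarrow> nat) \<Rightarrow> real set" where
  "cluster_union q E f = {q} \<union> (\<Union>n. cball q (1 / Suc n) \<inter> (\<Union>k\<le>f n. E k))"

lemma cluster_union_in_compact_sets_rat:
  assumes "q \<in> \<rat>" and "\<And>k. E k \<in> compact_sets_rat"
  shows "cluster_union q E f \<in> compact_sets_rat"
proof -
  have "compact (cball q (1 / Suc n) \<inter> (\<Union>k\<le>f n. E k))" for n
    using assms(2) by (intro compact_Int compact_UN) (auto simp: compact_sets_rat_iff)
  then have "compact (cluster_union q E f)"
    unfolding cluster_union_def by (intro compact_union_converging) auto
  then show ?thesis
    using assms by (auto simp: compact_sets_rat_iff cluster_union_def)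
qed

text \<open>
  In a nonempty countable perfect set the complements of the points would be countably many dense
  open sets with empty intersection.
\<close>

lemma countable_perfect_real_set_empty:
  fixes P :: "real set"
  assumes "closed P" "countable P" and "\<And>q. q \<in> P \<Longrightarrow> q islimpt P"
  shows "P = {}"
proof (rule ccontr)
  assume "P \<noteq> {}"
  have "P \<subseteq> closure (\<Inter>q\<in>P. P - {q})"
  proof (rule Baire[OF \<open>closed P\<close>])
    fix T assume "T \<in> (\<lambda>q. P - {q}) ` P"
    then obtain q where q: "q \<in> P" "T = P - {q}"
      by blast
    have "openin (top_of_set P) T"
      using q by (metis Diff_eq Int_commute closed_singleton open_Compl openin_open_Int)
    moreover have "q \<in> closure T"
      using assms(3)[OF q(1)] q(2) by (metis closure_def UnCI islimpt_punctured mem_Collect_eq)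
    then have "P \<subseteq> closure T"
      using q closure_subset[of T] by auto
    ultimately show "openin (top_of_set P) T \<and> P \<subseteq> closure T"
      by blast
  qed (use \<open>countable P\<close> in auto)
  moreover have "(\<Inter>q\<in>P. P - {q}) = {}"
    using \<open>P \<noteq> {}\<close> by auto
  ultimately show False
    using \<open>P \<noteq> {}\<close> by simp
qed

text \<open>
  A Cantor-Bendixson argument without ranks. The points of \<open>F\<close> none of whose neighbourhoods in \<open>F\<close>
  is covered by finitely many members of \<open>W\<close> form a closed set \<open>P\<close>. An isolated point \<open>q\<close> of \<open>P\<close>
  is impossible: the parts of \<open>F\<close> in small annuli around \<open>q\<close> do not meet \<open>P\<close>, so by compactness
  finite subfamilies \<open>g n\<close> of \<open>W\<close> cover them, and the closure property of \<open>W\<close> amalgamates these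
  into one member that covers a neighbourhood of \<open>q\<close>. Thus \<open>P\<close> is perfect and countable, hence empty.
\<close>

lemma compact_sets_rat_finitely_covered:
  assumes F: "F \<in> compact_sets_rat"
    and step: "\<And>q g. \<lbrakk>q \<in> \<rat>; \<And>n. finite (g n) \<and> g n \<subseteq> W\<rbrakk>
      \<Longrightarrow> \<exists>U\<in>W. q \<in> U \<and> (\<forall>n. cball q (1 / Suc n) \<inter> \<Union>(g n) \<subseteq> U)"
  shows "\<exists>\<E>\<subseteq>W. finite \<E> \<and> F \<subseteq> \<Union>\<E>"
proof -
  define cov where "cov X \<longleftrightarrow> (\<exists>\<E>\<subseteq>W. finite \<E> \<and> X \<subseteq> \<Union>\<E>)" for X
  have cov_mono: "cov X" if "cov Y" "X \<subseteq> Y" for X Y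
    using that unfolding cov_def by (meson order_trans)
  define P where "P = {x \<in> F. \<forall>r>0. \<not> cov (F \<inter> cball x r)}"
  have cF: "compact F" "F \<subseteq> \<rat>"
    using F by (auto simp: compact_sets_rat_iff)
  have good: "cov X" if "compact X" "X \<subseteq> F" "X \<inter> P = {}" for X
  proof -
    have "\<exists>r. x \<in> X \<longrightarrow> r > 0 \<and> cov (F \<inter> cball x r)" for x
      using that unfolding P_def by blast
    then obtain r where r: "\<And>x. x \<in> X \<Longrightarrow> r x > 0 \<and> cov (F \<inter> cball x (r x))"
      by metis
    obtain Z where Z: "Z \<subseteq> X" "finite Z" "X \<subseteq> (\<Union>x\<in>Z. ball x (r x))"
      by (rule compactE_image[OF \<open>compact X\<close>, of X "\<lambda>x. ball x (r x)"]) (use r in auto)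
    have "\<forall>x\<in>Z. \<exists>\<E>. \<E> \<subseteq> W \<and> finite \<E> \<and> F \<inter> cball x (r x) \<subseteq> \<Union>\<E>"
      using r Z(1) unfolding cov_def by blast
    from bchoice[OF this] obtain \<E> where
      \<E>: "\<And>x. x \<in> Z \<Longrightarrow> \<E> x \<subseteq> W \<and> finite (\<E> x) \<and> F \<inter> cball x (r x) \<subseteq> \<Union>(\<E> x)"
      by blast
    have "X \<subseteq> \<Union>(\<Union>x\<in>Z. \<E> x)"
    proof
      fix y assume "y \<in> X"
      then obtain x where "x \<in> Z" "y \<in> ball x (r x)"
        using Z(3) by blast
      then have "y \<in> F \<inter> cball x (r x)"
        using \<open>y \<in> X\<close> \<open>X \<subseteq> F\<close> by auto
      then show "y \<in> \<Union>(\<Union>x\<in>Z. \<E> x)"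
        using \<E>[OF \<open>x \<in> Z\<close>] \<open>x \<in> Z\<close> by blast
    qed
    moreover have "(\<Union>x\<in>Z. \<E> x) \<subseteq> W" "finite (\<Union>x\<in>Z. \<E> x)"
      using \<E> \<open>finite Z\<close> by auto
    ultimately show ?thesis
      unfolding cov_def by blast
  qed
  have "closed P"
  proof -
    have "closure P \<subseteq> F"
      by (intro closure_minimal compact_imp_closed cF) (auto simp: P_def)
    have "y \<in> P" if "y \<in> closure P" for y
    proof -
      have "y \<in> F"
        using that \<open>closure P \<subseteq> F\<close> by blast
      moreover have "\<not> cov (F \<inter> cball y r)" if "r > 0" for r
      proof
        assume "cov (F \<inter> cball y r)"
        obtain x where "x \<in> P" "dist x y < r / 2"
          using \<open>y \<in> closure P\<close> \<open>r > 0\<close> by (metis closure_approachable half_gt_zero)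
        then have "cball x (r / 2) \<subseteq> cball y r"
          by (simp add: cball_subset_cball_iff)
        then have "cov (F \<inter> cball x (r / 2))"
          using cov_mono[OF \<open>cov (F \<inter> cball y r)\<close>] by blast
        then show False
          using \<open>x \<in> P\<close> \<open>r > 0\<close> unfolding P_def by (metis (mono_tags, lifting) half_gt_zero mem_Collect_eq)
      qed
      ultimately show ?thesis
        unfolding P_def by blast
    qed
    then show ?thesis
      by (metis closure_subset closure_eq subsetI subset_antisym)
  qed
  have "q islimpt P" if "q \<in> P" for q
  proof (rule ccontr)
    assume "\<not> q islimpt P"
    then obtain d where "d > 0" and d: "\<And>x. \<lbrakk>x \<in> P; dist x q < d\<rbrakk> \<Longrightarrow> x = q"
      unfolding islimpt_approachable by blast
    define r where "r = min (d / 2) 1"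
    have r: "r > 0" "r < d" "r \<le> 1"
      using \<open>d > 0\<close> by (auto simp: r_def min_def)
    \<comment> \<open>The inner ball is open, so that these annular parts of \<open>F\<close> are compact; their overlap in
      the bounding spheres is harmless.\<close>
    define X where "X n = F \<inter> cball q r \<inter> (cball q (1 / Suc n) - ball q (1 / Suc (Suc n)))" for n
    have "\<forall>n. cov (X n)"
    proof (intro allI good)
      fix n
      show "compact (X n)"
        unfolding X_def using cF by (intro compact_Int compact_diff) auto
      show "X n \<inter> P = {}"
        using d r(2) unfolding X_def by (fastforce simp: dist_commute)
    qed (auto simp: X_def)
    from choice[OF this[unfolded cov_def]] obtain g where
      g: "\<And>n. g n \<subseteq> W \<and> finite (g n) \<and> X n \<subseteq> \<Union>(g n)"
      by blast
    have "q \<in> \<rat>"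
      using \<open>q \<in> P\<close> cF by (auto simp: P_def)
    then obtain U where U: "U \<in> W" "q \<in> U" "\<And>n. cball q (1 / Suc n) \<inter> \<Union>(g n) \<subseteq> U"
      using step[of q g] g by blast
    \<comment> \<open>Each point of the ball other than \<open>q\<close> lies in the annulus given by the least \<open>n\<close> whose inner
      radius does not exceed its distance from \<open>q\<close>; here \<open>r \<le> 1\<close> covers the case \<open>n = 0\<close>.\<close>
    have "F \<inter> cball q r \<subseteq> U"
    proof
      fix x assume x: "x \<in> F \<inter> cball q r"
      show "x \<in> U"
      proof (cases "x = q")
        case False
        then have "dist q x > 0"
          by simp
        define n where "n = (LEAST n. 1 / Suc (Suc n) \<le> dist q x)"
        have ex: "\<exists>n. 1 / Suc (Suc n) \<le> dist q x"
        proof -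
          obtain m where "1 / real (Suc m) < dist q x"
            using nat_approx_posE[OF \<open>dist q x > 0\<close>] by blast
          moreover have "1 / real (Suc (Suc m)) \<le> 1 / real (Suc m)"
            by (simp add: frac_le)
          ultimately show ?thesis
            by (meson le_less_trans less_imp_le)
        qed
        have low: "1 / Suc (Suc n) \<le> dist q x"
          unfolding n_def using ex by (rule LeastI_ex)
        have "dist q x \<le> 1 / Suc n"
        proof (cases n)
          case 0
          then show ?thesis
            using x r(3) by simp
        next
          case (Suc k)
          then have "\<not> 1 / Suc (Suc k) \<le> dist q x"
            unfolding n_def by (intro not_less_Least) simp
          with Suc show ?thesis by simp
        qed
        with low x have "x \<in> X n"
          by (simp add: X_def)
        then show ?thesis
          using g U(3) unfolding X_def by blast
      qed (use U in simp)
    qed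
    then have "cov (F \<inter> cball q r)"
      unfolding cov_def using U(1) by (intro exI[of _ "{U}"]) auto
    with \<open>q \<in> P\<close> \<open>r > 0\<close> show False
      unfolding P_def by blast
  qed
  moreover have "countable P"
    using cF countable_rat by (auto simp: P_def intro: countable_subset)
  ultimately have "P = {}"
    using \<open>closed P\<close> countable_perfect_real_set_empty by blast
  then show ?thesis
    using good[OF cF(1)] unfolding cov_def by simp
qed

text \<open>
  If \<open>\<aleph>\<^sub>1\<close> functions dominate all functions from \<open>\<nat>\<close> to \<open>\<nat>\<close>, then \<open>\<aleph>\<^sub>1\<close> compact sets of
  rationals are cofinal. The dominating family comes as the union of the countable levels \<open>N \<xi>\<close>.
  Countable families \<open>G \<xi>\<close> of compact sets are built by recursion: for every \<open>\<zeta> \<le> \<xi>\<close>, the earlier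
  families \<open>G \<eta>\<close>, \<open>\<eta> < \<zeta>\<close>, are enumerated in a sequence, and its clusters at all rationals with
  bounds from level \<open>\<xi>\<close> are put into \<open>G \<xi>\<close>. Given countably many members of the union, all of them occur
  in one of these sequences, and a function that bounds their positions is dominated by some
  member of the family; so the union satisfies the closure property required by
  \<open>compact_sets_rat_finitely_covered\<close>.
\<close>

lemma compact_sets_rat_cofinal_omega1:
  fixes N :: "omega1 \<Rightarrow> 'n set" and \<phi> :: "'n \<Rightarrow> nat \<Rightarrow> nat"
  assumes N: "\<And>\<xi>. countable (N \<xi>)" "\<And>\<xi> \<zeta>. \<xi> \<le> \<zeta> \<Longrightarrow> N \<xi> \<subseteq> N \<zeta>"
    and dom: "\<And>h. \<exists>\<xi>. \<exists>\<nu>\<in>N \<xi>. \<forall>n. h n \<le> \<phi> \<nu> n"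
  shows "\<exists>H :: omega1 \<Rightarrow> real set.
    (\<forall>\<xi>. H \<xi> \<in> compact_sets_rat) \<and> (\<forall>F\<in>compact_sets_rat. \<exists>\<xi>. F \<subseteq> H \<xi>)"
proof -
  \<comment> \<open>The empty set is included because \<open>from_nat_into\<close> enumerates nonempty sets only.\<close>
  define C where "C g \<zeta> = insert {} (\<Union>\<eta>\<in>{..<\<zeta>}. g \<eta>)" for g :: "omega1 \<Rightarrow> real set set" and \<zeta>
  define R where "R g \<xi> = (\<Union>\<zeta>\<in>{..\<xi>}. (\<lambda>(q, \<nu>). cluster_union q (from_nat_into (C g \<zeta>)) (\<phi> \<nu>)) ` (\<rat> \<times> N \<xi>))"
    for g \<xi>
  have "\<exists>G. \<forall>\<xi>. G \<xi> = R G \<xi>"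
  proof (rule dependent_wellorder_choice)
    fix f g :: "omega1 \<Rightarrow> real set set" and \<xi> r assume "\<And>\<eta>. \<eta> < \<xi> \<Longrightarrow> f \<eta> = g \<eta>"
    then have "C f \<zeta> = C g \<zeta>" if "\<zeta> \<le> \<xi>" for \<zeta>
      using that unfolding C_def by (intro arg_cong[where f = "insert {}"] SUP_cong) auto
    then have "R f \<xi> = R g \<xi>"
      unfolding R_def by (intro SUP_cong) auto
    then show "(r = R f \<xi>) = (r = R g \<xi>)"
      by simp
  qed blast
  then obtain G where G: "\<And>\<xi>. G \<xi> = R G \<xi>"
    by blast
  have in_G: "cluster_union q (from_nat_into (C G \<zeta>)) (\<phi> \<nu>) \<in> G \<xi>"
    if "\<zeta> \<le> \<xi>" "q \<in> \<rat>" "\<nu> \<in> N \<xi>" for q \<zeta> \<nu> \<xi>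
    unfolding G[of \<xi>] R_def using that by force
  have G_props: "countable (G \<xi>) \<and> G \<xi> \<subseteq> compact_sets_rat" for \<xi>
  proof (induction \<xi> rule: less_induct)
    case (less \<xi>)
    have "countable {..\<xi>}"
      using countable_lessThan_omega1[of \<xi>] by (metis countable_insert ivl_disj_un_singleton(2) Un_insert_right sup_bot.right_neutral)
    then have "countable (R G \<xi>)"
      unfolding R_def using N(1) countable_rat by (intro countable_UN countable_image countable_SIGMA) auto
    moreover have "E \<in> compact_sets_rat" if E: "E \<in> C G \<zeta>" "\<zeta> \<le> \<xi>" for E \<zeta>
    proof (cases "E = {}")
      case False
      then obtain \<eta> where "\<eta> < \<zeta>" "E \<in> G \<eta>"
        using E(1) unfolding C_def by blast
      then have "\<eta> < \<xi>"
        using E(2) by simp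
      then show ?thesis
        using less[of \<eta>] \<open>E \<in> G \<eta>\<close> by blast
    qed (simp add: compact_sets_rat_iff)
    then have "from_nat_into (C G \<zeta>) k \<in> compact_sets_rat" if "\<zeta> \<le> \<xi>" for \<zeta> k
      using from_nat_into[of "C G \<zeta>" k] that by (simp add: C_def)
    then have "R G \<xi> \<subseteq> compact_sets_rat"
      unfolding R_def using cluster_union_in_compact_sets_rat by auto
    ultimately show ?case
      by (simp flip: G)
  qed
  have cC: "countable (C G \<zeta>)" for \<zeta>
    unfolding C_def using G_props countable_lessThan_omega1 by auto
  have bounded: "\<exists>\<zeta>. \<A> \<subseteq> (\<Union>\<eta>\<in>{..<\<zeta>}. G \<eta>)" if "countable \<A>" "\<A> \<subseteq> (\<Union>\<xi>. G \<xi>)" for \<A>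
  proof -
    have "\<exists>\<eta>. E \<in> \<A> \<longrightarrow> E \<in> G \<eta>" for E
      using that(2) by blast
    then obtain i where i: "\<And>E. E \<in> \<A> \<Longrightarrow> E \<in> G (i E)"
      by metis
    obtain \<zeta> where "\<And>\<eta>. \<eta> \<in> i ` \<A> \<Longrightarrow> \<eta> < \<zeta>"
      using countable_imp_bounded_omega1 countable_image \<open>countable \<A>\<close> by metis
    then show ?thesis
      using i by blast
  qed
  have step: "\<exists>U\<in>(\<Union>\<xi>. G \<xi>). q \<in> U \<and> (\<forall>n. cball q (1 / Suc n) \<inter> \<Union>(g n) \<subseteq> U)"
    if "q \<in> \<rat>" and g: "\<And>n. finite (g n) \<and> g n \<subseteq> (\<Union>\<xi>. G \<xi>)" for q g
  proof -
    have "countable (\<Union>n. g n)"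
      using g by (simp add: countable_finite)
    moreover have "(\<Union>n. g n) \<subseteq> (\<Union>\<xi>. G \<xi>)"
      using g by blast
    ultimately obtain \<zeta> where "(\<Union>n. g n) \<subseteq> (\<Union>\<eta>\<in>{..<\<zeta>}. G \<eta>)"
      using bounded by meson
    then have gC: "g n \<subseteq> C G \<zeta>" for n
      unfolding C_def by blast
    have "\<exists>m. \<forall>E\<in>g n. to_nat_on (C G \<zeta>) E \<le> m" for n
      using g[of n] by (metis finite_imageI finite_nat_set_iff_bounded_le image_eqI)
    then obtain h where h: "\<And>n E. E \<in> g n \<Longrightarrow> to_nat_on (C G \<zeta>) E \<le> h n"
      by metis
    obtain \<xi> \<nu> where \<nu>: "\<nu> \<in> N \<xi>" "\<And>n. h n \<le> \<phi> \<nu> n"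
      using dom[of h] by blast
    define U where "U = cluster_union q (from_nat_into (C G \<zeta>)) (\<phi> \<nu>)"
    have "U \<in> G (max \<xi> \<zeta>)"
      unfolding U_def using N(2)[of \<xi> "max \<xi> \<zeta>"] \<nu> \<open>q \<in> \<rat>\<close> by (intro in_G) auto
    moreover have "q \<in> U"
      by (simp add: U_def cluster_union_def)
    moreover have "cball q (1 / Suc n) \<inter> \<Union>(g n) \<subseteq> U" for n
    proof -
      have "E \<subseteq> (\<Union>k\<le>\<phi> \<nu> n. from_nat_into (C G \<zeta>) k)" if "E \<in> g n" for E
      proof -
        have "from_nat_into (C G \<zeta>) (to_nat_on (C G \<zeta>) E) = E"
          using cC gC that by (meson from_nat_into_to_nat_on subsetD)
        moreover have "to_nat_on (C G \<zeta>) E \<le> \<phi> \<nu> n"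
          using h[OF that] \<nu>(2) order_trans by blast
        ultimately show ?thesis by blast
      qed
      then have "\<Union>(g n) \<subseteq> (\<Union>k\<le>\<phi> \<nu> n. from_nat_into (C G \<zeta>) k)"
        by (rule Union_least)
      then have "cball q (1 / Suc n) \<inter> \<Union>(g n)
          \<subseteq> (\<Union>n. cball q (1 / Suc n) \<inter> (\<Union>k\<le>\<phi> \<nu> n. from_nat_into (C G \<zeta>) k))"
        by (intro UN_upper[THEN order_trans[rotated]]) auto
      then show ?thesis
        unfolding U_def cluster_union_def by (rule le_supI2)
    qed
    ultimately show ?thesis by blast
  qed
  define \<U> where "\<U> \<xi> = Union ` {\<E>. finite \<E> \<and> \<E> \<subseteq> (\<Union>\<eta>\<in>{..<\<xi>}. G \<eta>)}" for \<xi>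
  have "countable (\<U> \<xi>)" for \<xi>
    unfolding \<U>_def using G_props countable_lessThan_omega1
    by (intro countable_image countable_Collect_finite_subset countable_UN) auto
  moreover have "(\<Union>\<xi>. \<U> \<xi>) \<noteq> {}"
    unfolding \<U>_def by blast
  ultimately obtain H :: "omega1 \<Rightarrow> real set" where H: "range H = (\<Union>\<xi>. \<U> \<xi>)"
    by (rule omega1_enumeration)
  show ?thesis
  proof (intro exI[of _ H] conjI allI ballI)
    have "\<Union>\<E> \<in> compact_sets_rat" if "finite \<E>" "\<E> \<subseteq> (\<Union>\<eta>\<in>{..<\<xi>}. G \<eta>)" for \<E> \<xi>
    proof -
      have "\<E> \<subseteq> compact_sets_rat"
        using that G_props by blast
      then show ?thesis
        using \<open>finite \<E>\<close> by (auto simp: compact_sets_rat_iff subset_iff intro!: compact_Union)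
    qed
    then have "(\<Union>\<xi>. \<U> \<xi>) \<subseteq> compact_sets_rat"
      unfolding \<U>_def by blast
    then show "H \<xi> \<in> compact_sets_rat" for \<xi>
      using H by blast
    show "\<exists>\<xi>. F \<subseteq> H \<xi>" if F: "F \<in> compact_sets_rat" for F
    proof -
      obtain \<E> where \<E>: "\<E> \<subseteq> (\<Union>\<xi>. G \<xi>)" "finite \<E>" "F \<subseteq> \<Union>\<E>"
        using compact_sets_rat_finitely_covered[OF F step] by blast
      then obtain \<zeta> where "\<E> \<subseteq> (\<Union>\<eta>\<in>{..<\<zeta>}. G \<eta>)"
        using bounded[OF countable_finite] by blast
      then have "\<Union>\<E> \<in> range H"
        unfolding H \<U>_def using \<E>(2) by blast
      with \<E>(3) show ?thesis by blast
    qed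
  qed
qed

section \<open>Compact sets with good neighbourhoods\<close>

lemma countable_base_for_compacts:
  obtains \<O> :: "'a :: second_countable_topology set set"
  where "countable \<O>"
    and "\<And>F U. \<lbrakk>compact F; open U; F \<subseteq> U\<rbrakk> \<Longrightarrow> \<exists>V\<in>\<O>. F \<subseteq> V \<and> V \<subseteq> U"
proof -
  obtain \<B> :: "'a set set" where "countable \<B>" and \<B>: "topological_basis \<B>"
    using ex_countable_basis by blast
  show thesis
  proof (rule that)
    show "countable (Union ` {\<V>. finite \<V> \<and> \<V> \<subseteq> \<B>})"
      using \<open>countable \<B>\<close> by (intro countable_image countable_Collect_finite_subset)
    fix F U :: "'a set" assume "compact F" "open U" "F \<subseteq> U"
    obtain \<B>' where \<B>': "\<B>' \<subseteq> \<B>" "\<Union>\<B>' = U"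
      using \<B> \<open>open U\<close> unfolding topological_basis_def by blast
    have "open B" if "B \<in> \<B>'" for B
      using topological_basis_open[OF \<B>] \<B>'(1) that by blast
    then obtain \<V> where "\<V> \<subseteq> \<B>'" "finite \<V>" "F \<subseteq> \<Union>\<V>"
      using compactE[OF \<open>compact F\<close>, of \<B>'] \<B>'(2) \<open>F \<subseteq> U\<close> by blast
    then show "\<exists>V\<in>Union ` {\<V>. finite \<V> \<and> \<V> \<subseteq> \<B>}. F \<subseteq> V \<and> V \<subseteq> U"
      using \<B>' by blast
  qed
qed

text \<open>
  Call a member \<open>V\<close> of a countable base for compact sets bad if the sets \<open>K G\<close> with \<open>G \<subseteq> V\<close> do not
  contain a countable finally dense set between them. By \<open>countable_cover_finally_dense\<close> the bad
  members do not account for all points of the cube; any \<open>F\<close> with a remaining point in \<open>K F\<close> is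
  contained in no bad member.
\<close>

lemma finally_dense_near_some_compact:
  assumes K: "directed_compact_cover compact_sets_rat K"
  shows "\<exists>F\<in>compact_sets_rat. \<forall>U. open U \<longrightarrow> F \<subseteq> U \<longrightarrow>
      (\<exists>D. countable D \<and> finally_dense D \<and> (\<forall>d\<in>D. \<exists>G\<in>compact_sets_rat. G \<subseteq> U \<and> d \<in> K G))"
proof -
  obtain \<O> :: "real set set" where "countable \<O>"
    and \<O>: "\<And>F U. \<lbrakk>compact F; open U; F \<subseteq> U\<rbrakk> \<Longrightarrow> \<exists>V\<in>\<O>. F \<subseteq> V \<and> V \<subseteq> U"
    using countable_base_for_compacts by blast
  define B where "B V = {x. \<exists>G\<in>compact_sets_rat. G \<subseteq> V \<and> x \<in> K G}" for V
  define \<S> where "\<S> = {V \<in> \<O>. \<nexists>D. countable D \<and> finally_dense D \<and> D \<subseteq> B V}"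
  have "countable \<S>"
    using \<open>countable \<O>\<close> unfolding \<S>_def by (rule countable_subset[rotated]) auto
  have "(\<Union>V\<in>\<S>. B V) \<noteq> UNIV"
  proof
    assume "(\<Union>V\<in>\<S>. B V) = UNIV"
    then obtain V D where "V \<in> \<S>" and D: "countable D" "D \<subseteq> B V" "finally_dense D"
      by (rule countable_cover_finally_dense[OF \<open>countable \<S>\<close>])
    from \<open>V \<in> \<S>\<close> have "\<nexists>D. countable D \<and> finally_dense D \<and> D \<subseteq> B V"
      unfolding \<S>_def by simp
    with D show False by blast
  qed
  then obtain x where x: "\<And>V. V \<in> \<S> \<Longrightarrow> x \<notin> B V"
    by blast
  have "x \<in> (\<Union>F\<in>compact_sets_rat. K F)"
    using K by (simp add: directed_compact_cover_def)
  then obtain F where F: "F \<in> compact_sets_rat" "x \<in> K F"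
    by (rule UN_E)
  show ?thesis
  proof (rule bexI[OF _ F(1)], intro allI impI)
    fix U :: "real set" assume "open U" "F \<subseteq> U"
    then obtain V where V: "V \<in> \<O>" "F \<subseteq> V" "V \<subseteq> U"
      using \<O> F(1) compact_sets_rat_iff by metis
    then have "x \<in> B V"
      using F unfolding B_def by blast
    then have "V \<notin> \<S>"
      using x by blast
    then have "\<exists>D. countable D \<and> finally_dense D \<and> D \<subseteq> B V"
      using V(1) unfolding \<S>_def mem_Collect_eq by meson
    then obtain D where D: "countable D" "finally_dense D" "D \<subseteq> B V"
      by (elim exE conjE)
    have "\<exists>G\<in>compact_sets_rat. G \<subseteq> U \<and> d \<in> K G" if "d \<in> D" for d
      using subsetD[OF D(3) that] order_trans[OF _ V(3)] unfolding B_def mem_Collect_eq by meson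
    with D show "\<exists>D. countable D \<and> finally_dense D \<and> (\<forall>d\<in>D. \<exists>G\<in>compact_sets_rat. G \<subseteq> U \<and> d \<in> K G)"
      by (intro exI[of _ D] conjI ballI)
  qed
qed

section \<open>Existence of a BIG member\<close>

theorem theorem4p11:
  fixes K :: "real set \<Rightarrow> cantor_cube set"
  assumes "directed_compact_cover compact_sets_rat K"
  shows "\<exists>F\<in>compact_sets_rat. BIG (K F)"
proof -
  have cK: "compact (K F)" and mono: "\<lbrakk>F' \<in> compact_sets_rat; F \<subseteq> F'\<rbrakk> \<Longrightarrow> K F \<subseteq> K F'"
    if "F \<in> compact_sets_rat" for F F'
    using assms that by (simp_all add: directed_compact_cover_def)
  have cover: "(\<Union>F\<in>compact_sets_rat. K F) = UNIV"
    using assms by (simp add: directed_compact_cover_def)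
  obtain F where F: "F \<in> compact_sets_rat" and near: "\<And>U. \<lbrakk>open U; F \<subseteq> U\<rbrakk> \<Longrightarrow>
      \<exists>D. countable D \<and> finally_dense D \<and> (\<forall>d\<in>D. \<exists>G\<in>compact_sets_rat. G \<subseteq> U \<and> d \<in> K G)"
    using finally_dense_near_some_compact[OF assms] by meson
  \<comment> \<open>A union of balls rather than a bound on the distance from \<open>F\<close>, so that the case \<open>F = {}\<close>
    is included.\<close>
  define U where "U n = (\<Union>y\<in>F. ball y (1 / Suc n))" for n
  have "\<forall>n. \<exists>D. countable D \<and> finally_dense D \<and> (\<forall>d\<in>D. \<exists>G\<in>compact_sets_rat. G \<subseteq> U n \<and> d \<in> K G)"
    by (intro allI near) (auto simp: U_def)
  from choice[OF this] obtain D where D: "\<forall>n. countable (D n) \<and> finally_dense (D n)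
      \<and> (\<forall>d\<in>D n. \<exists>G\<in>compact_sets_rat. G \<subseteq> U n \<and> d \<in> K G)" ..
  then have cD: "countable (D n)" and fD: "finally_dense (D n)"
    and KD: "\<forall>d\<in>D n. \<exists>G\<in>compact_sets_rat. G \<subseteq> U n \<and> d \<in> K G" for n
    by (rule allE, simp)+
  define \<Delta> where "\<Delta> n = (SOME \<delta>. \<forall>a b. finite a \<longrightarrow> finite b \<longrightarrow> a \<subseteq> {\<delta>..} \<longrightarrow> D n \<inter> cyl a b \<noteq> {})" for n
  have \<Delta>: "D n \<inter> cyl a b \<noteq> {}" if "finite a" "finite b" "a \<subseteq> {\<Delta> n..}" for n a b
    using someI_ex[OF fD[of n, unfolded finally_dense_def]] that unfolding \<Delta>_def by simp
  have "countable (range \<Delta>)"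
    by simp
  then obtain \<delta> where \<delta>: "\<And>n. \<Delta> n < \<delta>"
    using countable_imp_bounded_omega1 by (metis rangeI)
  have meets: "D n \<inter> cyl a b \<noteq> {}" if "finite a" "finite b" "a \<subseteq> {\<delta>..}" for n a b
    using that \<delta>[of n] by (intro \<Delta>) fastforce+
  have ne: "D n \<noteq> {}" for n
    using meets[of "{}" "{}" n] by auto
  define d where "d n = from_nat_into (D n)" for n
  have d: "range (d n) = D n" for n
    unfolding d_def using ne cD by (rule range_from_nat_into)
  define G where "G n k = (SOME G. G \<in> compact_sets_rat \<and> G \<subseteq> U n \<and> d n k \<in> K G)" for n k
  have G: "G n k \<in> compact_sets_rat \<and> G n k \<subseteq> U n \<and> d n k \<in> K (G n k)" for n k
  proof -
    have "\<exists>G. G \<in> compact_sets_rat \<and> G \<subseteq> U n \<and> d n k \<in> K G"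
      using bspec[OF KD, of "d n k" n] rangeI[of "d n" k] unfolding d by meson
    then show ?thesis
      unfolding G_def by (rule someI_ex)
  qed
  define F' where "F' h = F \<union> (\<Union>n. \<Union>k\<le>h n. G n k)" for h
  have F': "F' h \<in> compact_sets_rat" for h
  proof -
    have "(\<Union>k\<le>h n. G n k) \<subseteq> (\<Union>y\<in>F. cball y (1 / Suc n))" for n
    proof -
      have "U n \<subseteq> (\<Union>y\<in>F. cball y (1 / Suc n))"
        unfolding U_def by (intro UN_mono) auto
      with G show ?thesis by blast
    qed
    moreover have "compact (\<Union>k\<le>h n. G n k)" for n
      using G by (intro compact_UN) (auto simp: compact_sets_rat_iff)
    ultimately have "compact (F' h)"
      unfolding F'_def using F by (intro compact_union_converging) (auto simp: compact_sets_rat_iff)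
    moreover have "F' h \<subseteq> \<rat>"
      using F G unfolding F'_def by (auto simp: compact_sets_rat_iff)
    ultimately show ?thesis
      by (simp add: compact_sets_rat_iff)
  qed
  have d_in: "d n k \<in> K (F' h)" if "k \<le> h n" for n k h
  proof -
    have "G n k \<subseteq> F' h"
      using that unfolding F'_def by blast
    then show ?thesis
      using G[of n k] mono[OF _ F'] by blast
  qed
  show ?thesis
  proof (rule ccontr)
    assume "\<not> ?thesis"
    then have notBIG: "\<And>E. E \<in> compact_sets_rat \<Longrightarrow> \<not> BIG (K E)"
      by blast
    define \<phi> where "\<phi> p n = (LEAST k. d n k \<in> cyl (fst p) (snd p))" for p :: "omega1 set \<times> omega1 set" and n
    define N :: "omega1 \<Rightarrow> (omega1 set \<times> omega1 set) set" where
      "N \<xi> = {a. finite a \<and> a \<subseteq> {..<\<xi>}} \<times> {b. finite b \<and> b \<subseteq> {..<\<xi>}}" for \<xi>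
    have "countable (N \<xi>)" for \<xi>
      unfolding N_def using countable_lessThan_omega1
      by (intro countable_SIGMA countable_Collect_finite_subset)
    moreover have "N \<xi> \<subseteq> N \<zeta>" if "\<xi> \<le> \<zeta>" for \<xi> \<zeta>
      using that unfolding N_def by fastforce
    moreover have "\<exists>\<xi>. \<exists>\<nu>\<in>N \<xi>. \<forall>n. h n \<le> \<phi> \<nu> n" for h
    proof -
      obtain a b where ab: "finite a" "finite b" "a \<subseteq> {\<delta>..}" and miss: "K (F' h) \<inter> cyl a b = {}"
        using BIG_if_meets_cylinders[OF cK[OF F'[of h]], of \<delta>] notBIG[OF F'[of h]] by metis
      have "h n \<le> \<phi> (a, b) n" for n
      proof -
        obtain k where "d n k \<in> cyl a b"
          using meets[OF ab, of n] unfolding d[symmetric] by blast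
        then have "d n (\<phi> (a, b) n) \<in> cyl a b"
          unfolding \<phi>_def fst_conv snd_conv by (rule LeastI)
        then show ?thesis
          using miss d_in[of "\<phi> (a, b) n" h n] by fastforce
      qed
      moreover have "countable (a \<union> b)"
        using ab by (simp add: countable_finite)
      then obtain \<xi> where "\<And>\<gamma>. \<gamma> \<in> a \<union> b \<Longrightarrow> \<gamma> < \<xi>"
        using countable_imp_bounded_omega1 by blast
      then have "(a, b) \<in> N \<xi>"
        unfolding N_def using ab by auto
      ultimately show ?thesis by blast
    qed
    ultimately have "\<exists>H :: omega1 \<Rightarrow> real set.
        (\<forall>\<xi>. H \<xi> \<in> compact_sets_rat) \<and> (\<forall>F\<in>compact_sets_rat. \<exists>\<xi>. F \<subseteq> H \<xi>)"
      by (rule compact_sets_rat_cofinal_omega1)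
    then obtain H where H: "\<And>\<xi>. H \<xi> \<in> compact_sets_rat"
      and cofinal: "\<And>E. E \<in> compact_sets_rat \<Longrightarrow> \<exists>\<xi> :: omega1. E \<subseteq> H \<xi>"
      by meson
    have "K E \<subseteq> (\<Union>\<xi>. K (H \<xi>))" if E: "E \<in> compact_sets_rat" for E
    proof -
      obtain \<xi> where "E \<subseteq> H \<xi>"
        using cofinal[OF E] by (rule exE)
      then have "K E \<subseteq> K (H \<xi>)"
        by (rule mono[OF E H])
      then show ?thesis by blast
    qed
    then have "(\<Union>E\<in>compact_sets_rat. K E) \<subseteq> (\<Union>\<xi>. K (H \<xi>))"
      by (rule UN_least)
    then have "(\<Union>\<xi>. K (H \<xi>)) = UNIV"
      unfolding cover by (rule top_le)
    moreover have "(\<Union>\<xi>. K (H \<xi>)) \<noteq> UNIV"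
      by (rule omega1_many_not_BIG_do_not_cover[OF cK[OF H] notBIG[OF H]])
    ultimately show False
      by (rule notE[rotated])
  qed
qed

end
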